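(* There is a polynomial-time algorithm which, given a connected undirected multigraph $G=(V,E)$ (no loops) and functions $f,g:V\to\mathbb{N}$ with $f(v)+g(v)\le d(v)$ and $f(v)g(v)=0$ for every $v\in V$, decides whether $G$ has an acyclic orientation satisfying $f(v)\le\varrho(v)\le d(v)-g(v)$ for every $v\in V$.
   Context: $d(v)$ is the degree of $v$ in $G$ (counting parallel edges). For an orientation of $G$, $\varrho(v)$ is the indegree of $v$. An orientation is acyclic if it has no directed cycle. *)

theory Defs
  imports
    "HOL-Library.Log_Nat"
    "HOL-Computational_Algebra.Polynomial"
    "Graph_Theory.Arc_Walk"
begin

section \<open>Undirected multigraphs and their orientations\<close>

record ('v, 'e) mgraph =
  mverts :: "'v set"
  medges :: "'e set"
  mends :: "'e \<Rightarrow> 'v set"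

locale multigraph =
  fixes G :: "('v, 'e) mgraph"
  assumes finite_mverts: "finite (mverts G)"
    and finite_medges: "finite (medges G)"
    and mends_subset: "e \<in> medges G \<Longrightarrow> mends G e \<subseteq> mverts G"
    and no_loop: "e \<in> medges G \<Longrightarrow> card (mends G e) = 2"

definition mdegree :: "('v, 'e) mgraph \<Rightarrow> 'v \<Rightarrow> nat" where
  "mdegree G v = card {e \<in> medges G. v \<in> mends G e}"

definition mconnected :: "('v, 'e) mgraph \<Rightarrow> bool" where
  "mconnected G \<longleftrightarrow> mverts G \<noteq> {} \<and>
     (\<forall>u \<in> mverts G. \<forall>v \<in> mverts G.
        (u, v) \<in> {(x, y). \<exists>e \<in> medges G. mends G e = {x, y}}\<^sup>*)"

text \<open>An orientation keeps the identity of every edge, so parallel edges are oriented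
  independently of each other.\<close>

definition orientation_of :: "('v, 'e) mgraph \<Rightarrow> ('v, 'e) pre_digraph \<Rightarrow> bool" where
  "orientation_of G D \<longleftrightarrow> verts D = mverts G \<and> arcs D = medges G \<and>
     (\<forall>e \<in> medges G. mends G e = {tail D e, head D e})"

definition acyclic_digraph :: "('v, 'e) pre_digraph \<Rightarrow> bool" where
  "acyclic_digraph D \<longleftrightarrow> \<not> (\<exists>p. pre_digraph.cycle D p)"


section \<open>Polynomial time\<close>

text \<open>
  The machine model is the random access machine with addition and (truncated) subtraction as
  its only arithmetic, in the form of a structured programming language.  Its memory consists
  of arrays of natural numbers; a scalar variable is cell 0 of an array.  A program mentions only
  finitely many arrays, so they can be interleaved into a single memory with indirect addressing.

  Every elementary operation has unit cost.  As there is no multiplication, each step lengthens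
  the binary representation of the largest number in memory, or named as an address, by at most
  a constant.  Hence running times agree with those of Turing machines up to a polynomial, if
  inputs are measured by their binary length as below.
\<close>

type_synonym vname = string
type_synonym state = "vname \<Rightarrow> nat \<Rightarrow> nat"

datatype aexp = N nat | Cell vname aexp | Plus aexp aexp | Minus aexp aexp

datatype bexp = Less aexp aexp | Not bexp | And bexp bexp

datatype com =
    Skip
  | Assign vname aexp aexp  \<comment> \<open>\<open>Assign x i a\<close> stores \<open>a\<close> in cell \<open>i\<close> of array \<open>x\<close>\<close>
  | Seq com com
  | If bexp com com
  | While bexp com

primrec aval :: "aexp \<Rightarrow> state \<Rightarrow> nat" where
  "aval (N k) s = k"
| "aval (Cell x i) s = s x (aval i s)"
| "aval (Plus a b) s = aval a s + aval b s"
| "aval (Minus a b) s = aval a s - aval b s"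

primrec acost :: "aexp \<Rightarrow> nat" where
  "acost (N k) = 1"
| "acost (Cell x i) = 1 + acost i"
| "acost (Plus a b) = 1 + acost a + acost b"
| "acost (Minus a b) = 1 + acost a + acost b"

primrec bval :: "bexp \<Rightarrow> state \<Rightarrow> bool" where
  "bval (Less a b) s \<longleftrightarrow> aval a s < aval b s"
| "bval (Not b) s \<longleftrightarrow> \<not> bval b s"
| "bval (And b c) s \<longleftrightarrow> bval b s \<and> bval c s"

primrec bcost :: "bexp \<Rightarrow> nat" where
  "bcost (Less a b) = 1 + acost a + acost b"
| "bcost (Not b) = 1 + bcost b"
| "bcost (And b c) = 1 + bcost b + bcost c"

text \<open>\<open>exec c s t s'\<close>: started in \<open>s\<close>, the program \<open>c\<close> terminates in \<open>s'\<close> after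
  \<open>t\<close> steps.\<close>

inductive exec :: "com \<Rightarrow> state \<Rightarrow> nat \<Rightarrow> state \<Rightarrow> bool" where
  Skip: "exec Skip s 1 s"
| Assign: "exec (Assign x i a) s (1 + acost i + acost a) (s(x := (s x)(aval i s := aval a s)))"
| Seq: "\<lbrakk>exec c s t s'; exec d s' t' s''\<rbrakk> \<Longrightarrow> exec (Seq c d) s (t + t') s''"
| IfTrue: "\<lbrakk>bval b s; exec c s t s'\<rbrakk> \<Longrightarrow> exec (If b c d) s (1 + bcost b + t) s'"
| IfFalse: "\<lbrakk>\<not> bval b s; exec d s t s'\<rbrakk> \<Longrightarrow> exec (If b c d) s (1 + bcost b + t) s'"
| WhileFalse: "\<not> bval b s \<Longrightarrow> exec (While b c) s (1 + bcost b) s"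
| WhileTrue: "\<lbrakk>bval b s; exec c s t s'; exec (While b c) s' t' s''\<rbrakk>
    \<Longrightarrow> exec (While b c) s (1 + bcost b + t + t') s''"

inductive_cases SkipE: "exec Skip s t s'"
inductive_cases AssignE: "exec (Assign x i a) s t s'"
inductive_cases SeqE: "exec (Seq c d) s t s'"

lemma exec_deterministic:
  "exec c s t s' \<Longrightarrow> exec c s u s'' \<Longrightarrow> u = t \<and> s'' = s'"
proof (induction arbitrary: u s'' rule: exec.induct)
  case (Skip s)
  then show ?case by (rule SkipE) simp
next
  case (Assign x i a s)
  then show ?case by (rule AssignE) simp
next
  case (Seq c s t s1 d t' s2)
  from Seq.prems obtain t1 r t2 where "exec c s t1 r" "exec d r t2 s''" "u = t1 + t2"
    by (rule SeqE)
  with Seq.IH(1)[of t1 r] Seq.IH(2)[of t2 s''] show ?case by simp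
next
  case (IfTrue b s c t s' d)
  from IfTrue.prems IfTrue.hyps(1) obtain t1 where "exec c s t1 s''" "u = 1 + bcost b + t1"
    by (cases rule: exec.cases) auto
  with IfTrue.IH[of t1 s''] show ?case by simp
next
  case (IfFalse b s d t s' c)
  from IfFalse.prems IfFalse.hyps(1) obtain t1 where "exec d s t1 s''" "u = 1 + bcost b + t1"
    by (cases rule: exec.cases) auto
  with IfFalse.IH[of t1 s''] show ?case by simp
next
  case (WhileFalse b s c)
  from WhileFalse.prems WhileFalse.hyps show ?case
    by (cases rule: exec.cases) auto
next
  case (WhileTrue b s c t s1 t' s2)
  from WhileTrue.prems WhileTrue.hyps(1) obtain t1 r t2
    where "exec c s t1 r" "exec (While b c) r t2 s''" "u = 1 + bcost b + t1 + t2"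
    by (cases rule: exec.cases) auto
  with WhileTrue.IH(1)[of t1 r] WhileTrue.IH(2)[of t2 s''] show ?case by simp
qed

definition initial_state :: "nat list \<Rightarrow> state" where
  "initial_state w = (\<lambda>x i.
     if x = ''in'' \<and> i < length w then w ! i
     else if x = ''len'' \<and> i = 0 then length w
     else 0)"

text \<open>Total number of binary digits, with one delimiter per entry.\<close>

definition input_size :: "nat list \<Rightarrow> nat" where
  "input_size w = (\<Sum>x\<leftarrow>w. floorlog 2 x + 1)"

text \<open>
  One fixed program answers the question \<open>Q\<close> on all instances in \<open>I\<close> within a polynomial
  number of steps; nothing is required of it on inputs that do not encode an instance in \<open>I\<close>.
\<close>

definition decidable_in_polynomial_time ::
    "('a \<Rightarrow> nat list) \<Rightarrow> 'a set \<Rightarrow> ('a \<Rightarrow> bool) \<Rightarrow> bool" where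
  "decidable_in_polynomial_time enc I Q \<longleftrightarrow>
     (\<exists>(c :: com) (p :: nat poly). \<forall>x \<in> I. \<exists>t s.
        exec c (initial_state (enc x)) t s \<and>
        t \<le> poly p (input_size (enc x)) \<and>
        s ''out'' 0 = (if Q x then 1 else 0))"


section \<open>Instances\<close>

text \<open>
  As input to a program, a multigraph has vertices \<open>0, \<dots>, n - 1\<close> and is given by the list of
  its edges, each of them as a pair of end vertices in arbitrary order.  The edges are identified
  by their positions in this list, so repeated pairs are parallel edges.
\<close>

definition graph_of :: "nat \<Rightarrow> (nat \<times> nat) list \<Rightarrow> (nat, nat) mgraph" where
  "graph_of n es = \<lparr>mverts = {..<n}, medges = {..<length es},
     mends = (\<lambda>i. {fst (es ! i), snd (es ! i)})\<rparr>"

type_synonym inst = "nat \<times> (nat \<times> nat) list \<times> (nat \<Rightarrow> nat) \<times> (nat \<Rightarrow> nat)"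

fun encode :: "inst \<Rightarrow> nat list" where
  "encode (n, es, f, g) =
     [n, length es] @ concat (map (\<lambda>(u, v). [u, v]) es) @ map f [0..<n] @ map g [0..<n]"

end

theory Submission
  imports Defs
begin

text \<open>
  A lower bound on the outdegree of \<open>v\<close> is easiest to meet when \<open>v\<close> comes early in the order of an
  acyclic orientation, a lower bound on the indegree when it comes late.  No vertex has both kinds
  of bounds, so the two can be treated separately: an order \<open>p\<close> meeting the lower bounds \<open>f\<close> on
  indegrees and an order \<open>q\<close> meeting the lower bounds \<open>g\<close> on outdegrees combine into one meeting
  both, which lists the vertices with \<open>f v = 0\<close> as in \<open>q\<close> and then the others as in \<open>p\<close>.

  An order for \<open>f\<close> alone is found greedily: a vertex may come next as soon as \<open>f v\<close> of its edges
  lead to vertices already listed.  The greedy process gets stuck exactly if the remaining vertices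
  form a set that obstructs every order.  The bounds \<open>g\<close> are dealt with in the same way, from the
  end of the order.
\<close>

section \<open>Acyclic orientations and blocking sets\<close>

text \<open>Every nonempty closed walk contains a cycle, and a cycle is itself such a walk. This
  replaces cycles by the acyclicity of a relation, which well-foundedness can exploit.\<close>

lemma (in wf_digraph) acyclic_digraph_iff: "acyclic_digraph G \<longleftrightarrow> acyclic (arcs_ends G)"
proof
  assume a: "acyclic_digraph G"
  show "acyclic (arcs_ends G)"
  proof (rule acyclicI, intro allI notI)
    fix u assume "u \<rightarrow>\<^sup>+ u"
    then obtain p where "awalk u p u" "p \<noteq> []" by (auto simp: reachable1_awalk)
    then have "closed_w p" by (auto simp: closed_w_def)
    then show False using closed_w_imp_cycle a by (auto simp: acyclic_digraph_def)
  qed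
next
  assume "acyclic (arcs_ends G)"
  then show "acyclic_digraph G"
    by (auto simp: acyclic_digraph_def cycle_def acyclic_def reachable1_awalk)
qed

text \<open>A set of edges, not of neighbours, so that parallel edges are counted with
  multiplicity.\<close>

definition edges_into :: "('v, 'e) mgraph \<Rightarrow> 'v \<Rightarrow> 'v set \<Rightarrow> 'e set" where
  "edges_into G v S = {e \<in> medges G. \<exists>u \<in> S. mends G e = {u, v}}"

definition visit :: "('v, 'e) mgraph \<Rightarrow> ('v \<Rightarrow> nat) \<Rightarrow> 'v \<Rightarrow> 'v set \<Rightarrow> 'v set" where
  "visit G h v S = (if h v \<le> card (edges_into G v S) then insert v S else S)"

lemma fold_visit_increasing: "S \<subseteq> fold (visit G h) vs S"
proof (induction vs arbitrary: S)
  case (Cons v vs)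
  have "S \<subseteq> visit G h v S" by (auto simp: visit_def)
  with Cons[of "visit G h v S"] show ?case by simp
qed simp

lemma fold_visit_subset: "fold (visit G h) vs S \<subseteq> S \<union> set vs"
proof (induction vs arbitrary: S)
  case (Cons v vs)
  from Cons[of "visit G h v S"] show ?case by (auto simp: visit_def split: if_splits)
qed simp

definition sweeps :: "('v, 'e) mgraph \<Rightarrow> ('v \<Rightarrow> nat) \<Rightarrow> 'v list \<Rightarrow> nat \<Rightarrow> 'v set" where
  "sweeps G h vs k = (fold (visit G h) vs ^^ k) {}"

lemma sweeps_subset: "sweeps G h vs k \<subseteq> set vs"
proof (induction k)
  case (Suc k)
  then show ?case using fold_visit_subset[of G h vs "sweeps G h vs k"]
    by (auto simp: sweeps_def)
qed (simp add: sweeps_def)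

text \<open>A blocking set: whatever the order, its first vertex misses its bound \<open>h\<close>.\<close>

definition blocking :: "('v, 'e) mgraph \<Rightarrow> ('v \<Rightarrow> nat) \<Rightarrow> 'v set \<Rightarrow> bool" where
  "blocking G h U \<longleftrightarrow> U \<subseteq> mverts G \<and> U \<noteq> {} \<and>
     (\<forall>v \<in> U. card (edges_into G v (mverts G - U)) < h v)"

section \<open>Acyclic orientations with degree bounds exist unless a set blocks them\<close>

context multigraph
begin

lemma finite_edges_into [simp]: "finite (edges_into G v S)"
  using finite_medges by (simp add: edges_into_def)

lemma edges_into_mono: "S \<subseteq> T \<Longrightarrow> edges_into G v S \<subseteq> edges_into G v T"
  by (auto simp: edges_into_def)

lemma card_edges_into_mono: "S \<subseteq> T \<Longrightarrow> card (edges_into G v S) \<le> card (edges_into G v T)"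
  by (intro card_mono edges_into_mono) auto

lemma ends_distinct: "e \<in> medges G \<Longrightarrow> mends G e = {u, v} \<Longrightarrow> u \<noteq> v"
  using no_loop[of e] by auto

lemma wf_digraph_orientation: "orientation_of G D \<Longrightarrow> wf_digraph D"
  using mends_subset by unfold_locales (fastforce simp: orientation_of_def)+

lemma acyclic_orientation_iff:
  assumes "orientation_of G D"
  shows "acyclic_digraph D \<longleftrightarrow> acyclic ((\<lambda>e. (tail D e, head D e)) ` medges G)"
proof -
  interpret D: wf_digraph D using assms by (rule wf_digraph_orientation)
  show ?thesis using assms by (simp add: D.acyclic_digraph_iff arcs_ends_conv orientation_of_def)
qed

lemma mdegree_orientation:
  assumes "orientation_of G D"
  shows "mdegree G v = in_degree D v + out_degree D v"
proof -
  have "{e \<in> medges G. v \<in> mends G e} = in_arcs D v \<union> out_arcs D v"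
    using assms by (auto simp: orientation_of_def)
  \<comment> \<open>An arc both entering and leaving \<open>v\<close> would be a loop.\<close>
  moreover have "in_arcs D v \<inter> out_arcs D v = {}"
    using assms ends_distinct by (fastforce simp: orientation_of_def)
  moreover have "finite (in_arcs D v)" "finite (out_arcs D v)"
    using assms finite_medges by (auto simp: orientation_of_def in_arcs_def out_arcs_def)
  ultimately show ?thesis
    by (simp add: mdegree_def in_degree_def out_degree_def card_Un_disjoint)
qed

text \<open>A finite acyclic relation is well-founded, so \<open>U\<close> would have a minimal
  vertex. All its predecessors lie outside \<open>U\<close>, hence it meets its bound with edges
  leaving \<open>U\<close>, which blocking forbids. Stating this for a relation lets it be applied
  to the converse as well.\<close>

lemma acyclic_not_blocking:
  assumes "acyclic r" "r \<subseteq> mverts G \<times> mverts G"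
    and "\<And>v. v \<in> mverts G \<Longrightarrow> h v \<le> card (edges_into G v {u. (u, v) \<in> r})"
  shows "\<not> blocking G h U"
proof
  assume U: "blocking G h U"
  have "finite r" using assms(2) finite_mverts by (meson finite_SigmaI finite_subset)
  then have "wf r" using assms(1) by (rule finite_acyclic_wf)
  moreover obtain x where "x \<in> U" using U by (auto simp: blocking_def)
  ultimately obtain v where v: "v \<in> U" "\<And>u. (u, v) \<in> r \<Longrightarrow> u \<notin> U"
    by (metis wfE_min)
  have "{u. (u, v) \<in> r} \<subseteq> mverts G - U" using v(2) assms(2) by auto
  from card_edges_into_mono[OF this, of v] assms(3)[of v] v(1) U show False
    by (fastforce simp: blocking_def)
qed

text \<open>Outdegrees are the indegrees of the reversed orientation, and reversal keeps acyclicity;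
  so both claims come from \<open>acyclic_not_blocking\<close>, applied to the arc relation and to
  its converse.\<close>

lemma orientation_not_blocking:
  assumes "orientation_of G D" "acyclic_digraph D"
  shows "(\<And>v. v \<in> mverts G \<Longrightarrow> h v \<le> in_degree D v) \<Longrightarrow> \<not> blocking G h U"
    and "(\<And>v. v \<in> mverts G \<Longrightarrow> h v \<le> out_degree D v) \<Longrightarrow> \<not> blocking G h U"
proof -
  define r where "r = (\<lambda>e. (tail D e, head D e)) ` medges G"
  have r: "acyclic r" "r \<subseteq> mverts G \<times> mverts G"
    using assms mends_subset
    by (auto simp: r_def acyclic_orientation_iff) (auto simp: orientation_of_def)
  have "in_arcs D v \<subseteq> edges_into G v {u. (u, v) \<in> r}" for v
  proof
    fix e assume "e \<in> in_arcs D v"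
    then have "e \<in> medges G" "mends G e = {tail D e, v}" "(tail D e, v) \<in> r"
      using assms(1) by (auto simp: orientation_of_def r_def)
    then show "e \<in> edges_into G v {u. (u, v) \<in> r}" by (auto simp: edges_into_def)
  qed
  then have i: "in_degree D v \<le> card (edges_into G v {u. (u, v) \<in> r})" for v
    by (simp add: in_degree_def card_mono)
  have "out_arcs D v \<subseteq> edges_into G v {u. (u, v) \<in> r\<inverse>}" for v
  proof
    fix e assume "e \<in> out_arcs D v"
    then have "e \<in> medges G" "mends G e = {head D e, v}" "(head D e, v) \<in> r\<inverse>"
      using assms(1) by (auto simp: orientation_of_def r_def)
    then show "e \<in> edges_into G v {u. (u, v) \<in> r\<inverse>}" by (auto simp: edges_into_def)
  qed
  then have o: "out_degree D v \<le> card (edges_into G v {u. (u, v) \<in> r\<inverse>})" for v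
    unfolding out_degree_def by (intro card_mono) auto
  show "\<not> blocking G h U" if "\<And>v. v \<in> mverts G \<Longrightarrow> h v \<le> in_degree D v"
    using acyclic_not_blocking[OF r] order_trans[OF that i] by blast
  have "acyclic (r\<inverse>)" "r\<inverse> \<subseteq> mverts G \<times> mverts G" using r by auto
  from acyclic_not_blocking[OF this]
  show "\<not> blocking G h U" if "\<And>v. v \<in> mverts G \<Longrightarrow> h v \<le> out_degree D v"
    using order_trans[OF that o] by blast
qed

text \<open>The greedy construction: as long as vertices are missing, their set is not blocking, so
  one of them has enough edges into the part already ranked and can come next.\<close>

lemma ranking_if_not_blocking:
  assumes nb: "\<And>U. \<not> blocking G h U"
  obtains r :: "'v \<Rightarrow> nat" where "inj_on r (mverts G)"
    "\<And>v. v \<in> mverts G \<Longrightarrow> h v \<le> card (edges_into G v {u \<in> mverts G. r u < r v})"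
proof -
  \<comment> \<open>Induction on the number \<open>k\<close> of ranked vertices. All ranks stay
    below \<open>k\<close>, so \<open>k\<close> is free for the next vertex.\<close>
  have "\<exists>S r. S \<subseteq> mverts G \<and> card S = k \<and> inj_on r S \<and> r ` S \<subseteq> {..<k} \<and>
      (\<forall>v\<in>S. h v \<le> card (edges_into G v {u \<in> S. r u < r v}))"
    if "k \<le> card (mverts G)" for k
    using that
  proof (induction k)
    case 0
    show ?case by (rule exI[of _ "{}"]) simp
  next
    case (Suc k)
    then obtain S r where S: "S \<subseteq> mverts G" "card S = k" "inj_on r S" "r ` S \<subseteq> {..<k}"
      "\<And>v. v \<in> S \<Longrightarrow> h v \<le> card (edges_into G v {u \<in> S. r u < r v})" by auto
    have "mverts G - S \<noteq> {}" using S(1,2) Suc.prems by auto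
    then obtain v where v: "v \<in> mverts G" "v \<notin> S" "h v \<le> card (edges_into G v S)"
      using nb[of "mverts G - S"] S(1) by (auto simp: blocking_def not_less double_diff)
    let ?r = "r(v := k)"
    have bound: "h w \<le> card (edges_into G w {u \<in> insert v S. ?r u < ?r w})" if w: "w \<in> insert v S" for w
    proof -
      \<comment> \<open>As \<open>v\<close> gets the largest rank, exactly \<open>S\<close> lies
        below it, and nothing changes below the old vertices.\<close>
      have "{u \<in> insert v S. ?r u < ?r w} = (if w = v then S else {u \<in> S. r u < r w})"
        using w S(4) v(2) by (auto simp: image_subset_iff)
      with w S(5) v(3) show ?thesis by auto
    qed
    have inj: "inj_on ?r (insert v S)"
      using S(3,4) v(2) by (auto simp: inj_on_def image_subset_iff)
    have ran: "?r ` insert v S \<subseteq> {..<Suc k}" using S(4) by (auto simp: image_subset_iff less_SucI)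
    have card: "card (insert v S) = Suc k"
      using S(1,2) v(2) finite_mverts finite_subset by (subst card_insert_disjoint) auto
    have sub: "insert v S \<subseteq> mverts G" using S(1) v(1) by simp
    show ?case
      by (intro exI[of _ "insert v S"] exI[of _ ?r] conjI ballI) (fact sub card inj ran bound)+
  qed
  from this[OF order.refl] obtain S and r :: "'v \<Rightarrow> nat" where "S \<subseteq> mverts G" "card S = card (mverts G)" "inj_on r S"
      "\<forall>v\<in>S. h v \<le> card (edges_into G v {u \<in> S. r u < r v})" by blast
  moreover from this(1,2) have "S = mverts G" using finite_mverts by (simp add: card_subset_eq)
  ultimately show thesis using that by blast
qed

text \<open>Every edge is directed from its end of lower rank to that of higher rank. Injectivity
  excludes ties, and ranks increase along arcs, so no cycle can close.\<close>

lemma orientation_by_ranking: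
  fixes r :: "'v \<Rightarrow> nat"
  assumes "inj_on r (mverts G)"
  obtains D where "orientation_of G D" "acyclic_digraph D"
    "\<And>v. v \<in> mverts G \<Longrightarrow> in_degree D v = card (edges_into G v {u \<in> mverts G. r u < r v})"
    "\<And>v. v \<in> mverts G \<Longrightarrow> out_degree D v = card (edges_into G v {u \<in> mverts G. r v < r u})"
proof -
  have "\<exists>u v. mends G e = {u, v} \<and> r u < r v" if e: "e \<in> medges G" for e
  proof -
    obtain u v where uv: "mends G e = {u, v}" "u \<noteq> v"
      using no_loop[OF e] by (auto simp: card_2_iff)
    then have "r u \<noteq> r v" using mends_subset[OF e] assms by (auto simp: inj_on_def)
    with uv(1) show ?thesis by (metis insert_commute linorder_neqE_nat)
  qed
  then obtain t d where td: "\<And>e. e \<in> medges G \<Longrightarrow> mends G e = {t e, d e} \<and> r (t e) < r (d e)"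
    by metis
  define D where "D = \<lparr>verts = mverts G, arcs = medges G, tail = t, head = d\<rparr>"
  have D: "orientation_of G D" using td by (simp add: orientation_of_def D_def)
  have "(\<lambda>e. (tail D e, head D e)) ` medges G \<subseteq> measure r" using td by (auto simp: D_def)
  then have ac: "acyclic_digraph D"
    unfolding acyclic_orientation_iff[OF D] by (metis wf_acyclic wf_measure acyclic_subset)
  have te: "t e \<in> mverts G" "d e \<in> mverts G" if "e \<in> medges G" for e
    using td[OF that] mends_subset[OF that] by auto
  have "d e = v \<longleftrightarrow> (\<exists>u \<in> {u \<in> mverts G. r u < r v}. mends G e = {u, v})"
    "t e = v \<longleftrightarrow> (\<exists>u \<in> {u \<in> mverts G. r v < r u}. mends G e = {u, v})"
    if "e \<in> medges G" for e v
    using td[OF that] te[OF that] by (auto simp: doubleton_eq_iff)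
  then have "in_arcs D v = edges_into G v {u \<in> mverts G. r u < r v}"
    "out_arcs D v = edges_into G v {u \<in> mverts G. r v < r u}" for v
    unfolding in_arcs_def out_arcs_def edges_into_def D_def by simp_all blast+
  then show thesis using that[OF D ac] by (simp add: in_degree_def out_degree_def)
qed

lemma acyclic_orientation_iff_not_blocking:
  assumes fg: "\<And>v. v \<in> mverts G \<Longrightarrow> f v + g v \<le> mdegree G v \<and> f v * g v = 0"
  shows "(\<exists>D. orientation_of G D \<and> acyclic_digraph D \<and>
      (\<forall>v\<in>mverts G. f v \<le> in_degree D v \<and> in_degree D v \<le> mdegree G v - g v)) \<longleftrightarrow>
    (\<forall>U. \<not> blocking G f U \<and> \<not> blocking G g U)" (is "?L \<longleftrightarrow> ?R")
proof
  assume ?L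
  then obtain D where D: "orientation_of G D" "acyclic_digraph D"
    and b: "\<And>v. v \<in> mverts G \<Longrightarrow> f v \<le> in_degree D v \<and> in_degree D v \<le> mdegree G v - g v"
    by blast
  \<comment> \<open>The upper bound on the indegree is a lower bound on the outdegree. Since
    \<open>g v\<close> is at most the degree, the subtraction is not truncated.\<close>
  have "g v \<le> out_degree D v" if "v \<in> mverts G" for v
    using b[OF that] fg[OF that] mdegree_orientation[OF D(1), of v] by linarith
  with b show ?R using orientation_not_blocking[OF D] by blast
next
  assume ?R
  then have nb: "\<And>U. \<not> blocking G f U" "\<And>U. \<not> blocking G g U" by auto
  obtain p :: "'v \<Rightarrow> nat" where p: "inj_on p (mverts G)"
      "\<And>v. v \<in> mverts G \<Longrightarrow> f v \<le> card (edges_into G v {u \<in> mverts G. p u < p v})"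
    using ranking_if_not_blocking[OF nb(1)] by blast
  obtain q :: "'v \<Rightarrow> nat" where q: "inj_on q (mverts G)"
      "\<And>v. v \<in> mverts G \<Longrightarrow> g v \<le> card (edges_into G v {u \<in> mverts G. q u < q v})"
    using ranking_if_not_blocking[OF nb(2)] by blast
  define M where "M = Max (q ` mverts G)"
  have M: "q v \<le> M" if "v \<in> mverts G" for v
    using that finite_mverts by (simp add: M_def)
  \<comment> \<open>Vertices with \<open>f v = 0\<close> come first, in an order reversing
    \<open>q\<close>, with ranks at most \<open>M\<close>; the others follow in the order of
    \<open>p\<close>, with ranks above \<open>M\<close>.\<close>
  define r where "r v = (if f v = 0 then M - q v else Suc M + p v)" for v
  have "inj_on r (mverts G)"
  proof (rule inj_onI)
    fix u v assume uv: "u \<in> mverts G" "v \<in> mverts G" and e: "r u = r v"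
    from e M[OF uv(1)] M[OF uv(2)] have "p u = p v \<or> q u = q v"
      by (auto simp: r_def split: if_splits)
    with uv show "u = v" using p(1) q(1) by (meson inj_onD)
  qed
  then obtain D where D: "orientation_of G D" "acyclic_digraph D"
    "\<And>v. v \<in> mverts G \<Longrightarrow> in_degree D v = card (edges_into G v {u \<in> mverts G. r u < r v})"
    "\<And>v. v \<in> mverts G \<Longrightarrow> out_degree D v = card (edges_into G v {u \<in> mverts G. r v < r u})"
    using orientation_by_ranking by blast
  have "f v \<le> in_degree D v" if v: "v \<in> mverts G" for v
  proof (cases "f v = 0")
    case False
    \<comment> \<open>A vertex preceding \<open>v\<close> in \<open>p\<close> still precedes it:
      either it lies in the first block, or both are in the second, ordered by
      \<open>p\<close>.\<close>
    then have "{u \<in> mverts G. p u < p v} \<subseteq> {u \<in> mverts G. r u < r v}" by (auto simp: r_def)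
    from le_trans[OF p(2)[OF v] card_edges_into_mono[OF this]] D(3)[OF v] show ?thesis by simp
  qed simp
  moreover have "g v \<le> out_degree D v" if v: "v \<in> mverts G" for v
  proof (cases "g v = 0")
    case False
    then have "f v = 0" using fg[OF v] by simp
    \<comment> \<open>Now \<open>v\<close> is in the first block, where \<open>q\<close> is
      reversed, and the whole second block comes after it.\<close>
    then have "{u \<in> mverts G. q u < q v} \<subseteq> {u \<in> mverts G. r v < r u}"
      using M[OF v] by (auto simp: r_def)
    from le_trans[OF q(2)[OF v] card_edges_into_mono[OF this]] D(4)[OF v] show ?thesis by simp
  qed simp
  ultimately show ?L using D(1,2) by (force simp: mdegree_orientation)
qed

section \<open>Correctness of the greedy sweeps\<close>

lemma fold_visit_progress:
  assumes "v \<in> set vs" "h v \<le> card (edges_into G v S)"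
  shows "v \<in> fold (visit G h) vs S"
  using assms
proof (induction vs arbitrary: S)
  case (Cons w vs)
  let ?S = "visit G h w S"
  have "S \<subseteq> ?S" by (auto simp: visit_def)
  then have h: "h v \<le> card (edges_into G v ?S)"
    using Cons.prems(2) card_edges_into_mono le_trans by blast
  show ?case
  proof (cases "v \<in> set vs")
    case True
    with Cons.IH[of ?S] h show ?thesis by simp
  next
    case False
    then have "v \<in> ?S" using Cons.prems by (simp add: visit_def)
    then show ?thesis using fold_visit_increasing[of ?S G h vs] by auto
  qed
qed simp

text \<open>While the current set avoids \<open>U\<close>, a vertex of \<open>U\<close> sees only
  edges leaving \<open>U\<close>, too few to pass the test.\<close>

lemma fold_visit_blocking:
  assumes "blocking G h U" "set vs \<subseteq> mverts G" "S \<subseteq> mverts G - U"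
  shows "fold (visit G h) vs S \<subseteq> mverts G - U"
  using assms(2,3)
proof (induction vs arbitrary: S)
  case (Cons v vs)
  have "v \<notin> U" if "h v \<le> card (edges_into G v S)"
    using that assms(1) card_edges_into_mono[OF Cons.prems(2), of v] by (force simp: blocking_def)
  then have "visit G h v S \<subseteq> mverts G - U" using Cons.prems by (auto simp: visit_def)
  with Cons.IH[of "visit G h v S"] Cons.prems show ?case by simp
qed simp

text \<open>No sweep ever enters a blocking set. Without blocking sets, the complement of an
  incomplete set contains a vertex that passes the test, so each sweep makes progress and
  \<open>length vs\<close> sweeps suffice.\<close>

lemma sweeps_eq_verts_iff:
  assumes vs: "set vs = mverts G"
  shows "sweeps G h vs (length vs) = mverts G \<longleftrightarrow> (\<forall>U. \<not> blocking G h U)"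
proof
  assume e: "sweeps G h vs (length vs) = mverts G"
  show "\<forall>U. \<not> blocking G h U"
  proof (intro allI notI)
    fix U assume U: "blocking G h U"
    have "sweeps G h vs k \<subseteq> mverts G - U" for k
      using fold_visit_blocking[OF U] vs by (induction k) (simp_all add: sweeps_def)
    with e U show False by (fastforce simp: blocking_def)
  qed
next
  assume nb: "\<forall>U. \<not> blocking G h U"
  have sub: "sweeps G h vs k \<subseteq> mverts G" for k
    using sweeps_subset[of G h vs k] vs by simp
  have "sweeps G h vs k = mverts G \<or> k \<le> card (sweeps G h vs k)" for k
  proof (induction k)
    case (Suc k)
    let ?S = "sweeps G h vs k" and ?T = "sweeps G h vs (Suc k)"
    have T: "?T = fold (visit G h) vs ?S" by (simp add: sweeps_def)
    then have mono: "?S \<subseteq> ?T" by (simp add: fold_visit_increasing)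
    show ?case
    proof (cases "?S = mverts G")
      case True
      then show ?thesis using mono sub by blast
    next
      case False
      then have "mverts G - ?S \<noteq> {}" "mverts G - (mverts G - ?S) = ?S" using sub by blast+
      moreover have "\<not> blocking G h (mverts G - ?S)" using nb by blast
      ultimately obtain v where v: "v \<in> mverts G - ?S" "h v \<le> card (edges_into G v ?S)"
        unfolding blocking_def not_less[symmetric] by auto
      then have "v \<in> ?T" using fold_visit_progress vs T by auto
      then have "card ?S < card ?T" using v(1) mono finite_subset[OF sub finite_mverts]
        by (intro psubset_card_mono) auto
      then show ?thesis using Suc False by linarith
    qed
  qed simp
  \<comment> \<open>An inequality only, as the list \<open>vs\<close> may contain
    repetitions.\<close>
  moreover have "card (mverts G) \<le> length vs" using vs card_length by metis
  ultimately have "sweeps G h vs (length vs) = mverts G \<or> card (mverts G) \<le> card (sweeps G h vs (length vs))"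
    by (meson le_trans)
  then show "sweeps G h vs (length vs) = mverts G" using card_seteq[OF finite_mverts sub] by blast
qed

end

section \<open>Running times of programs\<close>

text \<open>Total correctness with a time bound. The postcondition is a predicate, so the
  specification of a second program can be nested into that of the first.\<close>

definition runs :: "nat \<Rightarrow> com \<Rightarrow> state \<Rightarrow> (state \<Rightarrow> bool) \<Rightarrow> bool" where
  "runs T c s Q \<longleftrightarrow> (\<exists>t s'. exec c s t s' \<and> t \<le> T \<and> Q s')"

lemma runs_Skip: "1 \<le> T \<Longrightarrow> Q s \<Longrightarrow> runs T Skip s Q"
  unfolding runs_def using exec.Skip by blast

lemma runs_Assign:
  "Q (s(x := (s x)(aval i s := aval a s))) \<Longrightarrow> 1 + acost i + acost a \<le> T \<Longrightarrow> runs T (Assign x i a) s Q"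
  unfolding runs_def using exec.Assign by blast

lemma runs_Seq:
  "runs T c s (\<lambda>s'. runs U d s' Q) \<Longrightarrow> T + U \<le> W \<Longrightarrow> runs W (Seq c d) s Q"
  unfolding runs_def by (meson add_mono exec.Seq le_trans)

lemma runs_If:
  assumes "bval b s \<Longrightarrow> runs T c s Q" "\<not> bval b s \<Longrightarrow> runs T d s Q" "1 + bcost b + T \<le> U"
  shows "runs U (If b c d) s Q"
proof -
  obtain t s' where "exec (If b c d) s (1 + bcost b + t) s'" "t \<le> T" "Q s'"
    using assms(1,2) exec.IfTrue exec.IfFalse unfolding runs_def by meson
  with assms(3) show ?thesis unfolding runs_def by (meson add_left_mono le_trans)
qed

definition loop :: "vname \<Rightarrow> aexp \<Rightarrow> com \<Rightarrow> com" where
  "loop x a c = Seq (Assign x (N 0) (N 0))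
     (While (Less (Cell x (N 0)) a) (Seq c (Assign x (N 0) (Plus (Cell x (N 0)) (N 1)))))"

text \<open>The invariant \<open>I k\<close> holds before round \<open>k\<close> and fixes both the
  counter and the value of the limit, which is evaluated anew in every test. A round costs
  \<open>T\<close> for the body, \<open>acost a + 4\<close> for the test and 6 for the increment;
  the initialization costs 3 and the failing last test \<open>acost a + 4\<close>.\<close>

lemma runs_loop:
  assumes init: "I 0 (s(x := (s x)(0 := 0)))"
    and body: "\<And>k s. k < n \<Longrightarrow> I k s \<Longrightarrow>
      runs T c s (\<lambda>s'. s' x 0 = k \<and> I (Suc k) (s'(x := (s' x)(0 := Suc k))))"
    and inv: "\<And>k s. I k s \<Longrightarrow> s x 0 = k \<and> aval a s = n"
    and final: "\<And>s. I n s \<Longrightarrow> Q s"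
    and le: "n * (T + acost a + 10) + acost a + 7 \<le> U"
  shows "runs U (loop x a c) s Q"
proof -
  let ?b = "Less (Cell x (N 0)) a" and ?d = "Assign x (N 0) (Plus (Cell x (N 0)) (N 1))"
  have "runs ((n - k) * (T + acost a + 10) + acost a + 4) (While ?b (Seq c ?d)) s Q"
    if "k \<le> n" "I k s" for k s
    using that
  \<comment> \<open>Downward from \<open>k = n\<close>, that is, on the number of remaining
    rounds.\<close>
  proof (induction k arbitrary: s rule: inc_induct)
    case base
    show ?case unfolding runs_def
    proof (intro exI conjI)
      show "exec (While ?b (Seq c ?d)) s (1 + bcost ?b) s"
        using inv[OF base] by (intro exec.WhileFalse) simp
    qed (use final[OF base] in simp_all)
  next
    case (step k)
    obtain t s' where s': "exec c s t s'" "t \<le> T" "s' x 0 = k"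
      "I (Suc k) (s'(x := (s' x)(0 := Suc k)))"
      using body[OF step.hyps(2) step.prems] by (auto simp: runs_def)
    have d: "exec (Seq c ?d) s (t + 6) (s'(x := (s' x)(0 := Suc k)))"
      using exec.Seq[OF s'(1) exec.Assign[of x "N 0" "Plus (Cell x (N 0)) (N 1)" s']] s'(3) by (simp add: numeral_eq_Suc)
    obtain u s'' where u: "exec (While ?b (Seq c ?d)) (s'(x := (s' x)(0 := Suc k))) u s''"
      "u \<le> (n - Suc k) * (T + acost a + 10) + acost a + 4" "Q s''"
      using step.IH[OF s'(4)] unfolding runs_def by blast
    have "bval ?b s" using inv[OF step.prems] step.hyps(2) by simp
    from exec.WhileTrue[OF this d u(1)] u(3) show ?case
    proof (unfold runs_def, intro exI conjI)
      have "n - k = Suc (n - Suc k)" using step.hyps(2) by simp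
      then show "1 + bcost ?b + (t + 6) + u \<le> (n - k) * (T + acost a + 10) + acost a + 4"
        using u(2) s'(2) by simp
    qed
  qed
  from this[OF _ init] show ?thesis unfolding loop_def
    by (intro runs_Seq[of 3 _ _ _ _ _ U, OF runs_Assign]) (use le in auto)
qed

abbreviation "var x \<equiv> Cell x (N 0)"
abbreviation "incr x \<equiv> Assign x (N 0) (Plus (var x) (N 1))"
abbreviation "Eq a b \<equiv> And (Not (Less a b)) (Not (Less b a))"
abbreviation "Or b c \<equiv> Not (And (Not b) (Not c))"

section \<open>The program\<close>

text \<open>Cells 0 and 1 form the header, so the pair of edge \<open>i\<close> starts at cell
  \<open>2 + (i + i)\<close>; doubling is by addition, as the machine cannot multiply.\<close>

abbreviation "num_verts \<equiv> Cell ''in'' (N 0)"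
abbreviation "num_edges \<equiv> Cell ''in'' (N 1)"
abbreviation "end1 i \<equiv> Cell ''in'' (Plus (N 2) (Plus i i))"
abbreviation "end2 i \<equiv> Cell ''in'' (Plus (N 3) (Plus i i))"
text \<open>Offset \<open>0\<close> selects the bound \<open>f v\<close>, offset \<open>n\<close> selects \<open>g v\<close>.\<close>

abbreviation "bound off v \<equiv> Cell ''in'' (Plus (Plus (N 2) (Plus num_edges num_edges)) (Plus off v))"

text \<open>The ends are stored in arbitrary order, so \<open>v\<close> may be either of them; the
  opposite end has to be marked in array \<open>x\<close>.\<close>

abbreviation "edge_test x \<equiv>
  Or (And (Eq (end1 (var ''i'')) (var ''v'')) (Less (N 0) (Cell x (end2 (var ''i'')))))
     (And (Eq (end2 (var ''i'')) (var ''v'')) (Less (N 0) (Cell x (end1 (var ''i'')))))"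

definition count_edges :: "vname \<Rightarrow> com" where
  "count_edges x = Seq (Assign ''c'' (N 0) (N 0)) (loop ''i'' num_edges
     (If (edge_test x) (incr ''c'') Skip))"

definition sweep :: "vname \<Rightarrow> aexp \<Rightarrow> com" where
  "sweep x off = loop ''v'' num_verts (Seq (count_edges x)
     (If (Less (var ''c'') (bound off (var ''v''))) Skip (Assign x (var ''v'') (N 1))))"

definition all_sweeps :: "vname \<Rightarrow> aexp \<Rightarrow> com" where
  "all_sweeps x off = loop ''k'' num_verts (sweep x off)"

text \<open>The arrays \<open>a\<close> and \<open>b\<close> collect the vertices reached for
  \<open>f\<close> and for \<open>g\<close>. The final scan withdraws the answer 1 when a vertex is
  missing from either.\<close>

definition main :: com where
  "main = Seq (all_sweeps ''a'' (N 0)) (Seq (all_sweeps ''b'' num_verts)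
     (Seq (Assign ''out'' (N 0) (N 1)) (loop ''v'' num_verts
       (If (And (Less (N 0) (Cell ''a'' (var ''v''))) (Less (N 0) (Cell ''b'' (var ''v''))))
         Skip (Assign ''out'' (N 0) (N 0))))))"

lemma nth_concat_pairs:
  assumes "i < length es"
  shows "concat (map (\<lambda>(u, v). [u, v]) es) ! (2 * i) = fst (es ! i)"
    and "concat (map (\<lambda>(u, v). [u, v]) es) ! Suc (2 * i) = snd (es ! i)"
  using assms
proof (induction es arbitrary: i)
  case (Cons e es)
  { case 1 then show ?case using Cons by (cases i) (auto split: prod.splits) }
  { case 2 then show ?case using Cons by (cases i) (auto split: prod.splits) }
qed simp_all

lemma length_concat_pairs: "length (concat (map (\<lambda>(u, v). [u, v]) es)) = 2 * length es"
  by (induction es) auto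

lemma length_le_input_size: "length w \<le> input_size w"
  by (induction w) (auto simp: input_size_def)

section \<open>Correctness and cost of the program on a fixed instance\<close>

context
  fixes n :: nat and es :: "(nat \<times> nat) list" and f g :: "nat \<Rightarrow> nat" and L :: nat
  assumes L: "n \<le> L" "length es \<le> L"
begin

text \<open>The addresses have the shape that \<open>aval\<close> produces, so that evaluated
  expressions match them directly.\<close>

definition holds_input :: "state \<Rightarrow> bool" where
  "holds_input s \<longleftrightarrow> s ''in'' 0 = n \<and> s ''in'' (Suc 0) = length es \<and>
    (\<forall>i<length es. s ''in'' (2 + (i + i)) = fst (es ! i) \<and> s ''in'' (3 + (i + i)) = snd (es ! i)) \<and>
    (\<forall>v<n. s ''in'' (2 + (length es + length es) + v) = f v \<and>
       s ''in'' (2 + (length es + length es) + (n + v)) = g v)"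

lemma holds_input_initial: "holds_input (initial_state (encode (n, es, f, g)))"
proof -
  define ps where "ps = concat (map (\<lambda>(u, v). [u, v]) es)"
  define w where "w = n # length es # ps @ map f [0..<n] @ map g [0..<n]"
  have ps: "length ps = 2 * length es" by (simp add: ps_def length_concat_pairs)
  have w: "initial_state w ''in'' i = w ! i" if "i < 2 + 2 * length es + 2 * n" for i
    using that ps by (simp add: initial_state_def w_def)
  have tail: "w ! (2 + j) = (ps @ map f [0..<n] @ map g [0..<n]) ! j" for j
    by (simp add: w_def)
  have "initial_state w ''in'' (2 + (i + i)) = fst (es ! i)"
    "initial_state w ''in'' (3 + (i + i)) = snd (es ! i)" if i: "i < length es" for i
  proof -
    have "2 + (i + i) = 2 + 2 * i" "3 + (i + i) = 2 + Suc (2 * i)" by simp_all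
    then show "initial_state w ''in'' (2 + (i + i)) = fst (es ! i)"
      "initial_state w ''in'' (3 + (i + i)) = snd (es ! i)"
      using w[of "2 + 2 * i"] w[of "2 + Suc (2 * i)"] tail[of "2 * i"] tail[of "Suc (2 * i)"]
        nth_concat_pairs[OF i] i ps by (simp_all only: ps_def[symmetric] nth_append) auto
  qed
  moreover have "initial_state w ''in'' (2 + (length es + length es) + v) = f v"
    "initial_state w ''in'' (2 + (length es + length es) + (n + v)) = g v" if v: "v < n" for v
  proof -
    have "2 + (length es + length es) + k = 2 + (length ps + k)" for k using ps by simp
    then show "initial_state w ''in'' (2 + (length es + length es) + v) = f v"
      "initial_state w ''in'' (2 + (length es + length es) + (n + v)) = g v"
      using w[of "2 + (length ps + v)"] w[of "2 + (length ps + (n + v))"]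
        tail[of "length ps + v"] tail[of "length ps + (n + v)"] v ps
      by (simp_all only: nth_append_length_plus) (auto simp: nth_append)
  qed
  moreover have "initial_state w ''in'' 0 = n" "initial_state w ''in'' (Suc 0) = length es"
    by (simp_all add: initial_state_def w_def)
  moreover have "encode (n, es, f, g) = w" by (simp add: w_def ps_def)
  ultimately show ?thesis by (simp only: holds_input_def) blast
qed

lemma holds_input_upd [simp]: "x \<noteq> ''in'' \<Longrightarrow> holds_input (s(x := z)) = holds_input s"
  by (simp add: holds_input_def)

lemma edges_into_graph_of:
  "edges_into (graph_of n es) v S = {i. i < length es \<and>
     (fst (es ! i) = v \<and> snd (es ! i) \<in> S \<or> snd (es ! i) = v \<and> fst (es ! i) \<in> S)}"
  by (auto simp: edges_into_def graph_of_def doubleton_eq_iff)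

definition marks :: "vname \<Rightarrow> nat set \<Rightarrow> state \<Rightarrow> bool" where
  "marks x S s \<longleftrightarrow> holds_input s \<and> (\<forall>u. s x u = of_bool (u \<in> S))"

text \<open>The exceptions are the mark array and the work variables of a sweep. Thus
  \<open>b\<close> is still zero after the sweeps for \<open>f\<close>, and the marks in
  \<open>a\<close> survive the sweeps for \<open>g\<close>.\<close>

definition frame :: "vname \<Rightarrow> state \<Rightarrow> state \<Rightarrow> bool" where
  "frame x q s \<longleftrightarrow> (\<forall>y. y \<notin> {x, ''k'', ''v'', ''i'', ''c''} \<longrightarrow> s y = q y)"

lemma frame_upd [simp]: "y \<in> {x, ''k'', ''v'', ''i'', ''c''} \<Longrightarrow> frame x q (s(y := z)) = frame x q s"
  by (auto simp: frame_def)

lemma marks_upd [simp]: "x \<noteq> y \<Longrightarrow> y \<noteq> ''in'' \<Longrightarrow> marks x S (s(y := z)) = marks x S s"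
  by (simp add: marks_def)

lemma marks_insert:
  "x \<noteq> ''in'' \<Longrightarrow> marks x S s \<Longrightarrow> marks x (insert v S) (s(x := (s x)(v := 1)))"
  by (simp add: marks_def)

lemma runs_count_edges:
  assumes x: "x \<notin> {''in'', ''k'', ''v'', ''i'', ''c''}"
    and s: "marks x S s" "frame x q s" "s ''k'' 0 = k" "s ''v'' 0 = v"
    and Q: "\<And>s'. marks x S s' \<Longrightarrow> frame x q s' \<Longrightarrow> s' ''k'' 0 = k \<Longrightarrow> s' ''v'' 0 = v \<Longrightarrow>
      s' ''c'' 0 = card (edges_into (graph_of n es) v S) \<Longrightarrow> Q s'"
  shows "runs (20 + L * 110) (count_edges x) s Q"
proof -
  \<comment> \<open>The edges counted by \<open>c\<close> after the first \<open>j\<close>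
    rounds.\<close>
  define E where "E j = {i. i < j \<and>
     (fst (es ! i) = v \<and> snd (es ! i) \<in> S \<or> snd (es ! i) = v \<and> fst (es ! i) \<in> S)}" for j
  have fin: "finite (E j)" for j by (simp add: E_def)
  have E: "E (Suc j) = (if fst (es ! j) = v \<and> snd (es ! j) \<in> S \<or> snd (es ! j) = v \<and> fst (es ! j) \<in> S
     then insert j (E j) else E j)" "j \<notin> E j" for j
    by (auto simp: E_def less_Suc_eq)
  define I where "I j s \<longleftrightarrow> marks x S s \<and> frame x q s \<and> s ''k'' 0 = k \<and> s ''v'' 0 = v \<and>
    s ''i'' 0 = j \<and> s ''c'' 0 = card (E j)" for j s
  have x': "''in'' \<noteq> x" "''k'' \<noteq> x" "''v'' \<noteq> x" "''i'' \<noteq> x" "''c'' \<noteq> x"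
    "x \<noteq> ''in''" "x \<noteq> ''k''" "x \<noteq> ''v''" "x \<noteq> ''i''" "x \<noteq> ''c''"
    using x by auto
  have body: "runs 90 (If (edge_test x) (incr ''c'') Skip) r
      (\<lambda>r'. r' ''i'' 0 = j \<and> I (Suc j) (r'(''i'' := (r' ''i'')(0 := Suc j))))"
    if j: "j < length es" "I j r" for j r
  proof -
    have "r ''in'' (2 + (j + j)) = fst (es ! j)" "r ''in'' (3 + (j + j)) = snd (es ! j)"
      "\<And>u. r x u = of_bool (u \<in> S)" "r ''i'' 0 = j" "r ''v'' 0 = v"
      using j unfolding I_def marks_def holds_input_def by blast+
    then have b: "bval (edge_test x) r \<longleftrightarrow>
        fst (es ! j) = v \<and> snd (es ! j) \<in> S \<or> snd (es ! j) = v \<and> fst (es ! j) \<in> S"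
      by (simp only: bval.simps aval.simps) (auto simp: not_less)
    show ?thesis
    proof (rule runs_If)
      assume "bval (edge_test x) r"
      with b E[of j] fin[of j] have "card (E (Suc j)) = Suc (card (E j))" by simp
      with j(2) show "runs 6 (incr ''c'') r
          (\<lambda>r'. r' ''i'' 0 = j \<and> I (Suc j) (r'(''i'' := (r' ''i'')(0 := Suc j))))"
        by (intro runs_Assign) (simp_all add: I_def x')
    next
      assume "\<not> bval (edge_test x) r"
      then have "E (Suc j) = E j" unfolding b E(1) by (rule if_not_P)
      with j(2) show "runs 6 Skip r
          (\<lambda>r'. r' ''i'' 0 = j \<and> I (Suc j) (r'(''i'' := (r' ''i'')(0 := Suc j))))"
        by (intro runs_Skip) (simp_all add: I_def x')
    qed simp
  qed
  have "runs (17 + L * 110) (loop ''i'' num_edges (If (edge_test x) (incr ''c'') Skip))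
      (s(''c'' := (s ''c'')(0 := 0))) Q"
  proof (rule runs_loop[where I = I and n = "length es", OF _ body])
    show "I 0 (s(''c'' := (s ''c'')(0 := 0), ''i'' := ((s(''c'' := (s ''c'')(0 := 0))) ''i'')(0 := 0)))"
      using s by (simp add: I_def E_def x')
    show "r ''i'' 0 = j \<and> aval num_edges r = length es" if "I j r" for j r
      using that by (simp add: I_def marks_def holds_input_def)
    show "Q r" if "I (length es) r" for r
      using that by (intro Q) (simp_all add: I_def E_def edges_into_graph_of)
    have "length es * 102 \<le> L * 110" using L by simp
    then show "length es * (90 + acost num_edges + 10) + acost num_edges + 7 \<le> 17 + L * 110" by simp
  qed
  then show ?thesis unfolding count_edges_def
    by (intro runs_Seq[where T = 3 and U = "17 + L * 110"] runs_Assign) simp_all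
qed

text \<open>The offset stays abstract, tied to \<open>h\<close> only through the cells it addresses,
  so that one proof covers both \<open>f\<close> and \<open>g\<close>.\<close>

lemma runs_sweep:
  assumes x: "x \<notin> {''in'', ''k'', ''v'', ''i'', ''c''}"
    and h: "\<And>r v. holds_input r \<Longrightarrow> v < n \<Longrightarrow>
      r ''in'' (2 + (length es + length es) + (aval off r + v)) = h v" "acost off \<le> 2"
    and s: "marks x S s" "frame x q s" "s ''k'' 0 = k"
    and Q: "\<And>r. marks x (fold (visit (graph_of n es) h) [0..<n] S) r \<Longrightarrow> frame x q r \<Longrightarrow> r ''k'' 0 = k \<Longrightarrow> Q r"
  shows "runs (20 + L * (70 + L * 110)) (sweep x off) s Q"
proof -
  \<comment> \<open>The marked set after the first \<open>j\<close> vertices of this sweep.\<close>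
  define A where "A j = fold (visit (graph_of n es) h) [0..<j] S" for j
  define I where "I j r \<longleftrightarrow> marks x (A j) r \<and> frame x q r \<and> r ''k'' 0 = k \<and> r ''v'' 0 = j" for j r
  have A: "A (Suc j) = visit (graph_of n es) h j (A j)" for j by (simp add: A_def)
  have x': "''in'' \<noteq> x" "''k'' \<noteq> x" "''v'' \<noteq> x" "''i'' \<noteq> x" "''c'' \<noteq> x"
    "x \<noteq> ''in''" "x \<noteq> ''k''" "x \<noteq> ''v''" "x \<noteq> ''i''" "x \<noteq> ''c''"
    using x by auto
  have body: "runs (50 + L * 110) (Seq (count_edges x)
      (If (Less (var ''c'') (bound off (var ''v''))) Skip (Assign x (var ''v'') (N 1)))) r
      (\<lambda>r'. r' ''v'' 0 = j \<and> I (Suc j) (r'(''v'' := (r' ''v'')(0 := Suc j))))"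
    if j: "j < n" "I j r" for j r
  proof (rule runs_Seq, rule runs_count_edges[OF x, of "A j" r q k j])
    fix r assume r: "marks x (A j) r" "frame x q r" "r ''k'' 0 = k" "r ''v'' 0 = j"
      "r ''c'' 0 = card (edges_into (graph_of n es) j (A j))"
    then have "holds_input r" by (simp add: marks_def)
    then have b: "bval (Less (var ''c'') (bound off (var ''v''))) r \<longleftrightarrow> card (edges_into (graph_of n es) j (A j)) < h j"
      using h(1)[OF _ j(1)] r(4,5) by (simp add: holds_input_def)
    show "runs 30 (If (Less (var ''c'') (bound off (var ''v''))) Skip (Assign x (var ''v'') (N 1))) r
      (\<lambda>r'. r' ''v'' 0 = j \<and> I (Suc j) (r'(''v'' := (r' ''v'')(0 := Suc j))))"
    proof (rule runs_If[where T = 4])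
      assume "bval (Less (var ''c'') (bound off (var ''v''))) r"
      then have "\<not> h j \<le> card (edges_into (graph_of n es) j (A j))" unfolding b by simp
      then have "A (Suc j) = A j" by (simp add: A visit_def)
      with r show "runs 4 Skip r
          (\<lambda>r'. r' ''v'' 0 = j \<and> I (Suc j) (r'(''v'' := (r' ''v'')(0 := Suc j))))"
        by (intro runs_Skip) (simp_all add: I_def x')
    next
      assume "\<not> bval (Less (var ''c'') (bound off (var ''v''))) r"
      then have "A (Suc j) = insert j (A j)" by (simp only: A visit_def b not_less if_True)
      with r marks_insert[OF x'(6) r(1), of j] show "runs 4 (Assign x (var ''v'') (N 1)) r
          (\<lambda>r'. r' ''v'' 0 = j \<and> I (Suc j) (r'(''v'' := (r' ''v'')(0 := Suc j))))"
        by (intro runs_Assign) (simp_all add: I_def x')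
    qed (use h(2) in simp)
  qed (use j(2) in \<open>simp_all add: I_def\<close>)
  show ?thesis unfolding sweep_def
  proof (rule runs_loop[where I = I and n = n, OF _ body])
    show "I 0 (s(''v'' := (s ''v'')(0 := 0)))"
      using s by (simp add: I_def A_def x')
    show "r ''v'' 0 = j \<and> aval num_verts r = n" if "I j r" for j r
      using that by (simp add: I_def marks_def holds_input_def)
    show "Q r" if "I n r" for r
      using that by (intro Q) (simp_all add: I_def A_def)
    have "n * (62 + L * 110) \<le> L * (70 + L * 110)" using L(1) by (intro mult_mono) auto
    then show "n * (50 + L * 110 + acost num_verts + 10) + acost num_verts + 7 \<le> 20 + L * (70 + L * 110)"
      by (simp add: algebra_simps)
  qed
qed

lemma runs_all_sweeps:
  assumes x: "x \<notin> {''in'', ''k'', ''v'', ''i'', ''c''}"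
    and h: "\<And>r v. holds_input r \<Longrightarrow> v < n \<Longrightarrow>
      r ''in'' (2 + (length es + length es) + (aval off r + v)) = h v" "acost off \<le> 2"
    and s: "marks x {} s"
    and Q: "\<And>r. marks x (sweeps (graph_of n es) h [0..<n] n) r \<Longrightarrow> frame x s r \<Longrightarrow> Q r"
  shows "runs (20 + L * (40 + L * (70 + L * 110))) (all_sweeps x off) s Q"
proof -
  define I where "I j r \<longleftrightarrow> marks x (sweeps (graph_of n es) h [0..<n] j) r \<and> frame x s r \<and> r ''k'' 0 = j" for j r
  have x': "x \<noteq> ''k''" using x by auto
  show ?thesis unfolding all_sweeps_def
  proof (rule runs_loop[where I = I and n = n])
    show "I 0 (s(''k'' := (s ''k'')(0 := 0)))"
      using s x' by (simp add: I_def sweeps_def) (simp add: frame_def)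
    show "runs (20 + L * (70 + L * 110)) (sweep x off) r
        (\<lambda>r'. r' ''k'' 0 = j \<and> I (Suc j) (r'(''k'' := (r' ''k'')(0 := Suc j))))"
      if "j < n" "I j r" for j r
    proof (rule runs_sweep[OF x, where off = off and h = h and q = s and k = j])
      show "marks x (sweeps (graph_of n es) h [0..<n] j) r" "frame x s r" "r ''k'' 0 = j"
        using that(2) by (simp_all add: I_def)
    qed (use h x' in \<open>simp_all add: I_def sweeps_def\<close>)
    show "r ''k'' 0 = j \<and> aval num_verts r = n" if "I j r" for j r
      using that by (simp add: I_def marks_def holds_input_def)
    show "Q r" if "I n r" for r
      using that by (intro Q) (simp_all add: I_def)
    have "n * (32 + L * (70 + L * 110)) \<le> L * (40 + L * (70 + L * 110))"
      using L(1) by (intro mult_mono) auto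
    then show "n * (20 + L * (70 + L * 110) + acost num_verts + 10) + acost num_verts + 7
        \<le> 20 + L * (40 + L * (70 + L * 110))"
      by (simp add: algebra_simps)
  qed
qed

text \<open>The bound adds up two runs of \<open>all_sweeps\<close> and \<open>20 + L * 40\<close>
  for the final scan. Its Horner form shows the coefficients of the polynomial in the
  theorem.\<close>

lemma runs_main:
  "runs (60 + L * (120 + L * (140 + L * 220))) main (initial_state (encode (n, es, f, g)))
    (\<lambda>s. s ''out'' 0 = of_bool (sweeps (graph_of n es) f [0..<n] n = {..<n} \<and> sweeps (graph_of n es) g [0..<n] n = {..<n}))"
  (is "runs _ _ ?s ?Q")
proof -
  define A B where "A = sweeps (graph_of n es) f [0..<n] n" and "B = sweeps (graph_of n es) g [0..<n] n"
  define c where "c = Seq (Assign ''out'' (N 0) (N 1)) (loop ''v'' num_verts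
     (If (And (Less (N 0) (Cell ''a'' (var ''v''))) (Less (N 0) (Cell ''b'' (var ''v''))))
       Skip (Assign ''out'' (N 0) (N 0))))"
  have out: "runs (20 + L * 40) c s ?Q" if s: "marks ''a'' A s" "marks ''b'' B s" for s
  proof -
    define I where "I j r \<longleftrightarrow> marks ''a'' A r \<and> marks ''b'' B r \<and> r ''v'' 0 = j \<and>
      r ''out'' 0 = of_bool (\<forall>u<j. u \<in> A \<inter> B)" for j r
    have body: "runs 20 (If (And (Less (N 0) (Cell ''a'' (var ''v''))) (Less (N 0) (Cell ''b'' (var ''v''))))
        Skip (Assign ''out'' (N 0) (N 0))) r
        (\<lambda>r'. r' ''v'' 0 = j \<and> I (Suc j) (r'(''v'' := (r' ''v'')(0 := Suc j))))"
      if "j < n" "I j r" for j r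
      using that(2)
      by (intro runs_If[where T = 3] runs_Skip runs_Assign)
        (auto simp: I_def less_Suc_eq marks_def)
    have "runs (17 + L * 40) (loop ''v'' num_verts
      (If (And (Less (N 0) (Cell ''a'' (var ''v''))) (Less (N 0) (Cell ''b'' (var ''v''))))
        Skip (Assign ''out'' (N 0) (N 0)))) (s(''out'' := (s ''out'')(0 := 1))) ?Q"
    proof (rule runs_loop[where I = I and n = n, OF _ body])
      show "I 0 (s(''out'' := (s ''out'')(0 := 1), ''v'' := ((s(''out'' := (s ''out'')(0 := 1))) ''v'')(0 := 0)))"
        using s by (simp add: I_def)
      show "r ''v'' 0 = j \<and> aval num_verts r = n" if "I j r" for j r
        using that by (simp add: I_def marks_def holds_input_def)
      have "A \<subseteq> {..<n}" "B \<subseteq> {..<n}"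
        using sweeps_subset[of "graph_of n es" f "[0..<n]" n] sweeps_subset[of "graph_of n es" g "[0..<n]" n]
        by (simp_all add: A_def B_def atLeast0LessThan)
      \<comment> \<open>Only numbers below \<open>n\<close> are ever marked, so the scan over them
        decides equality of sets.\<close>
      then have "(\<forall>u<n. u \<in> A \<inter> B) \<longleftrightarrow> A = {..<n} \<and> B = {..<n}" by auto
      then show "?Q r" if "I n r" for r using that by (simp add: I_def A_def B_def)
      show "n * (20 + acost num_verts + 10) + acost num_verts + 7 \<le> 17 + L * 40"
        using L(1) by simp
    qed
    then show ?thesis unfolding c_def
      by (intro runs_Seq[where T = 3 and U = "17 + L * 40"] runs_Assign) simp_all
  qed
  let ?P = "20 + L * (40 + L * (70 + L * 110))"
  \<comment> \<open>All arrays other than \<open>in\<close> and \<open>len\<close> start out zero,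
    which encodes the empty set.\<close>
  have init: "marks x {} ?s" if "x \<notin> {''in'', ''len''}" for x
    using that holds_input_initial by (auto simp: marks_def initial_state_def)
  have b: "runs ?P (all_sweeps ''b'' num_verts) r (\<lambda>r. runs (20 + L * 40) c r ?Q)"
    if r: "marks ''a'' A r" "frame ''a'' ?s r" for r
  proof (rule runs_all_sweeps[where h = g])
    show "marks ''b'' {} r" using r init[of "''b''"] by (simp add: marks_def frame_def)
    fix r' assume r': "marks ''b'' (sweeps (graph_of n es) g [0..<n] n) r'" "frame ''b'' r r'"
    then have "marks ''a'' A r'" using r(1) by (simp add: marks_def frame_def)
    with r'(1) show "runs (20 + L * 40) c r' ?Q" by (intro out) (simp_all add: B_def)
  qed (auto simp: holds_input_def)
  have "runs ?P (all_sweeps ''a'' (N 0)) ?s (\<lambda>r. runs (?P + (20 + L * 40))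
      (Seq (all_sweeps ''b'' num_verts) c) r ?Q)"
  proof (rule runs_all_sweeps[where h = f])
    show "marks ''a'' {} ?s" using init[of "''a''"] by simp
    fix r assume "marks ''a'' (sweeps (graph_of n es) f [0..<n] n) r" "frame ''a'' ?s r"
    then show "runs (?P + (20 + L * 40)) (Seq (all_sweeps ''b'' num_verts) c) r ?Q"
      by (intro runs_Seq[OF b order.refl]) (simp_all add: A_def)
  qed (auto simp: holds_input_def)
  then show ?thesis unfolding main_def c_def[symmetric]
    by (rule runs_Seq) (simp add: algebra_simps)
qed

end

theorem theorem2:
  shows "decidable_in_polynomial_time encode
    {(n, es, f, g). let G = graph_of n es in
       multigraph G \<and> mconnected G \<and>
       (\<forall>v \<in> mverts G. f v + g v \<le> mdegree G v \<and> f v * g v = 0)}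
    (\<lambda>(n, es, f, g). let G = graph_of n es in
       \<exists>D. orientation_of G D \<and> acyclic_digraph D \<and>
         (\<forall>v \<in> mverts G. f v \<le> in_degree D v \<and> in_degree D v \<le> mdegree G v - g v))"
  (is "decidable_in_polynomial_time encode ?I ?Q")
  unfolding decidable_in_polynomial_time_def
proof (intro exI[of _ main] exI[of _ "[:60, 120, 140, 220:]"] ballI)
  fix x assume x: "x \<in> ?I"
  obtain n es f g where xe: "x = (n, es, f, g)" by (cases x)
  define L where "L = input_size (encode x)"
  \<comment> \<open>The encoding has two header entries, two per edge and two per vertex, and every
    entry adds at least 1 to the input size.\<close>
  have "2 + 2 * length es + 2 * n \<le> L"
    using length_le_input_size[of "encode x"] by (simp add: xe L_def length_concat_pairs)
  then have L: "n \<le> L" "length es \<le> L" by simp_all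
  interpret multigraph "graph_of n es" using x by (simp add: xe Let_def)
  have v: "set [0..<n] = mverts (graph_of n es)" by (auto simp: graph_of_def)
  have "?Q x \<longleftrightarrow> (\<forall>U. \<not> blocking (graph_of n es) f U \<and> \<not> blocking (graph_of n es) g U)"
    using acyclic_orientation_iff_not_blocking[of f g] x by (simp add: xe Let_def)
  also have "\<dots> \<longleftrightarrow> sweeps (graph_of n es) f [0..<n] n = {..<n} \<and> sweeps (graph_of n es) g [0..<n] n = {..<n}"
    using sweeps_eq_verts_iff[OF v, of f] sweeps_eq_verts_iff[OF v, of g] by (simp add: graph_of_def) blast
  finally show "\<exists>t s. exec main (initial_state (encode x)) t s \<and>
      t \<le> poly [:60, 120, 140, 220:] (input_size (encode x)) \<and> s ''out'' 0 = (if ?Q x then 1 else 0)"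
    using runs_main[OF L, of f g] unfolding runs_def L_def[symmetric] xe[symmetric]
    by (simp add: of_bool_def algebra_simps)
qed

end
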